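(* Let $\mathsf{A}\in\mathbb{R}^{J_1\times J_1\times\cdots\times J_N\times J_N}$ and $\mathsf{B}\in\mathbb{R}^{J_1\times K_1\times\cdots\times J_N\times K_N}$, and let $$\mathscr{R}=\begin{vmatrix}\mathsf{B}&\mathsf{A}*\mathsf{B}&\cdots&\mathsf{A}^{\Pi_{\mathcal{J}}-1}*\mathsf{B}\end{vmatrix}\in\mathbb{R}^{J_1\times J_1K_1\times\cdots\times J_N\times J_NK_N}$$ be the reachability tensor, where $\Pi_{\mathcal{J}}=\prod_{n=1}^NJ_n$. If $\operatorname{rank}_{2n-1}(\mathscr{R})\ne J_n$ for some $n\in\{1,\dots,N\}$, then the pair $(\mathsf{A},\mathsf{B})$ is not reachable.
   Context: Einstein products: $(\mathsf{A}*\mathsf{X})_{j_1\cdots j_N}=\sum_{i_1,\dots,i_N}\mathsf{A}_{j_1i_1\cdots j_Ni_N}\mathsf{X}_{i_1\cdots i_N}$ for an $N$-th order $\mathsf{X}$, and $(\mathsf{A}*\mathsf{B})_{j_1i_1\cdots j_Ni_N}=\sum_{k_1,\dots,k_N}\mathsf{A}_{j_1k_1\cdots j_Nk_N}\mathsf{B}_{k_1i_1\cdots k_Ni_N}$ for even-order paired tensors; $\mathsf{A}^k$ is the $k$-fold Einstein product, $\mathsf{A}^0$ being the identity tensor for $*$. The pair $(\mathsf{A},\mathsf{B})$ is reachable on $[t_0,t_1]$ ($t_0<t_1$ integers) if for any $\mathsf{X}_0,\mathsf{X}_1\in\mathbb{R}^{J_1\times\cdots\times J_N}$ there are inputs $\mathsf{U}_t\in\mathbb{R}^{K_1\times\cdots\times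 K_N}$, $t_0\le t\le t_1-1$, steering $\mathsf{X}_{t+1}=\mathsf{A}*\mathsf{X}_t+\mathsf{B}*\mathsf{U}_t$ from $\mathsf{X}_{t_0}=\mathsf{X}_0$ to $\mathsf{X}_{t_1}=\mathsf{X}_1$. The pair is reachable if it is reachable on some interval $[t_0,t_1]$. Mode row block tensor: given $P=P_1\cdots P_N$ tensors $\mathsf{Z}_1,\dots,\mathsf{Z}_P\in\mathbb{R}^{J_1\times K_1\times\cdots\times J_N\times K_N}$, the tensor $\begin{vmatrix}\mathsf{Z}_1&\cdots&\mathsf{Z}_P\end{vmatrix}\in\mathbb{R}^{J_1\times K_1P_1\times\cdots\times J_N\times K_NP_N}$ is obtained by concatenating consecutive groups of $P_1$ tensors along the second index of the first pair, then consecutive groups of $P_2$ of the results along the second index of the second pair, and so on; explicitly its entry at $(j_1,l_1,\dots,j_N,l_N)$ with $l_n=(p_n-1)K_n+k_n$, $1\le k_n\le K_n$, $1\le p_n\le P_n$, is $(\mathsf{Z}_p)_{j_1k_1\cdots j_Nk_N}$ with $p=p_1+\sum_{n=2}^N(p_n-1)\prod_{l=1}^{n-1}P_l$. For $\mathscr{R}$ one takes $P_n=J_n$ and $\mathsf{Z}_p=\mathsf{A}^{p-1}*\mathsf{B}$. $\operatorname{rank}_m(\mathsf{Y})$ denotes the rank of the $m$-mode matricization of $\mathsf{Y}$ (rows indexed by the $m$-th index, columns by all other indices jointly). *)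

theory Defs
  imports "Jordan_Normal_Form.DL_Rank" "HOL-Library.FuncSet"
begin

text \<open>
  The order and the mode sizes of a tensor vary, so a tensor of shape \<open>ds = [d\<^sub>1, ..., d\<^sub>M]\<close> is an
  extensional function on multi-indices. A multi-index is a list of length \<open>M\<close>.
  All indices and all mode numbers start from 0.
\<close>

type_synonym tensor = "nat list \<Rightarrow> real"

definition indices :: "nat list \<Rightarrow> nat list set" where
  "indices ds = {is. list_all2 (<) is ds}"

definition tensors :: "nat list \<Rightarrow> tensor set" where
  "tensors ds = indices ds \<rightarrow>\<^sub>E UNIV"

text \<open>
  A tensor of shape \<open>J\<^sub>1 \<times> K\<^sub>1 \<times> ... \<times> J\<^sub>N \<times> K\<^sub>N\<close> has shape \<open>splice J K\<close>: the library function
  \<^const>\<open>splice\<close> interleaves two lists. For lists of equal length, \<open>rows\<close> and \<open>columns\<close> recover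
  \<open>js\<close> and \<open>ks\<close> from \<open>splice js ks\<close>.
\<close>

definition rows :: "nat list \<Rightarrow> nat list" where
  "rows ls = nths ls {n. even n}"

definition columns :: "nat list \<Rightarrow> nat list" where
  "columns ls = nths ls {n. odd n}"

definition tensor_add :: "nat list \<Rightarrow> tensor \<Rightarrow> tensor \<Rightarrow> tensor" where
  "tensor_add ds X Y = (\<lambda>is\<in>indices ds. X is + Y is)"

text \<open>Here \<open>A\<close> has shape \<open>splice J I\<close> and \<open>X\<close> has shape \<open>I\<close>; the result has shape \<open>J\<close>.\<close>

definition einstein_apply :: "nat list \<Rightarrow> nat list \<Rightarrow> tensor \<Rightarrow> tensor \<Rightarrow> tensor" where
  "einstein_apply J I A X = (\<lambda>js\<in>indices J. \<Sum>is\<in>indices I. A (splice js is) * X is)"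

text \<open>
  Here \<open>A\<close> has shape \<open>splice J K\<close> and \<open>B\<close> has shape \<open>splice K I\<close>; the result has shape
  \<open>splice J I\<close>.
\<close>

definition einstein_mult :: "nat list \<Rightarrow> nat list \<Rightarrow> nat list \<Rightarrow> tensor \<Rightarrow> tensor \<Rightarrow> tensor" where
  "einstein_mult J K I A B =
    (\<lambda>ls\<in>indices (splice J I).
      \<Sum>ks\<in>indices K. A (splice (rows ls) ks) * B (splice ks (columns ls)))"

definition identity_tensor :: "nat list \<Rightarrow> tensor" where
  "identity_tensor J = (\<lambda>ls\<in>indices (splice J J). if rows ls = columns ls then 1 else 0)"

primrec einstein_power :: "nat list \<Rightarrow> tensor \<Rightarrow> nat \<Rightarrow> tensor" where
  "einstein_power J A 0 = identity_tensor J"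
| "einstein_power J A (Suc k) = einstein_mult J J J A (einstein_power J A k)"

definition reachable_on ::
  "nat list \<Rightarrow> nat list \<Rightarrow> tensor \<Rightarrow> tensor \<Rightarrow> int \<Rightarrow> int \<Rightarrow> bool" where
  "reachable_on J K A B t\<^sub>0 t\<^sub>1 \<longleftrightarrow>
    (\<forall>X\<^sub>0\<in>tensors J. \<forall>X\<^sub>1\<in>tensors J.
      \<exists>(U :: int \<Rightarrow> tensor) (X :: int \<Rightarrow> tensor).
        (\<forall>t\<in>{t\<^sub>0..t\<^sub>1 - 1}. U t \<in> tensors K) \<and>
        (\<forall>t\<in>{t\<^sub>0..t\<^sub>1 - 1}.
          X (t + 1) = tensor_add J (einstein_apply J J A (X t)) (einstein_apply J K B (U t))) \<and>
        X t\<^sub>0 = X\<^sub>0 \<and> X t\<^sub>1 = X\<^sub>1)"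

definition reachable :: "nat list \<Rightarrow> nat list \<Rightarrow> tensor \<Rightarrow> tensor \<Rightarrow> bool" where
  "reachable J K A B \<longleftrightarrow> (\<exists>t\<^sub>0 t\<^sub>1. t\<^sub>0 < t\<^sub>1 \<and> reachable_on J K A B t\<^sub>0 t\<^sub>1)"

definition block_number :: "nat list \<Rightarrow> nat list \<Rightarrow> nat" where
  "block_number P ps = (\<Sum>n<length P. ps ! n * (\<Prod>l<n. P ! l))"

text \<open>
  The mode row block tensor of \<open>Z 0, ..., Z (prod_list P - 1)\<close>, each of shape \<open>splice J K\<close>.
  Writing \<open>l\<^sub>n = p\<^sub>n * K\<^sub>n + k\<^sub>n\<close> with \<open>k\<^sub>n < K\<^sub>n\<close>, we have \<open>p\<^sub>n = l\<^sub>n div K\<^sub>n\<close> and \<open>k\<^sub>n = l\<^sub>n mod K\<^sub>n\<close>.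
\<close>

definition mode_row_block ::
  "nat list \<Rightarrow> nat list \<Rightarrow> nat list \<Rightarrow> (nat \<Rightarrow> tensor) \<Rightarrow> tensor" where
  "mode_row_block J K P Z =
    (\<lambda>ls\<in>indices (splice J (map2 (*) K P)).
      let js = rows ls;
          ps = map2 (div) (columns ls) K;
          ks = map2 (mod) (columns ls) K
      in Z (block_number P ps) (splice js ks))"

text \<open>The shape of the reachability tensor is \<open>splice J (map2 (*) K J)\<close>.\<close>

definition reachability_tensor :: "nat list \<Rightarrow> nat list \<Rightarrow> tensor \<Rightarrow> tensor \<Rightarrow> tensor" where
  "reachability_tensor J K A B =
    mode_row_block J K J (\<lambda>p. einstein_mult J J K (einstein_power J A p) B)"

text \<open>
  The list \<open>product_lists (map (upt 0) es)\<close> enumerates the multi-indices of shape \<open>es\<close>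
  lexicographically; the order of the columns does not affect the rank.
\<close>

definition matricization :: "nat list \<Rightarrow> nat \<Rightarrow> tensor \<Rightarrow> real mat" where
  "matricization ds m Y =
    mat_of_cols (ds ! m)
      (map (\<lambda>is. vec (ds ! m) (\<lambda>i. Y (take m is @ i # drop m is)))
        (product_lists (map (upt 0) (take m ds @ drop (Suc m) ds))))"

definition mode_rank :: "nat list \<Rightarrow> nat \<Rightarrow> tensor \<Rightarrow> nat" where
  "mode_rank ds m Y = vec_space.rank (ds ! m) (matricization ds m Y)"

end

theory Submission
  imports Defs
begin

text \<open>
  If mode \<open>2n - 1\<close> of the reachability tensor is rank deficient, some \<open>v \<noteq> 0\<close> annihilates all of its
  mode fibres. Placing \<open>v\<close> on the line \<open>(0, ..., 0, i, 0, ..., 0)\<close> in direction \<open>n\<close> gives a nonzero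
  functional \<open>w\<close> on states with \<open>w A\<^sup>p B = 0\<close> for all \<open>p\<close> below the dimension of the state space,
  hence for all \<open>p\<close>. So \<open>w\<close> vanishes on every state reached from 0, and \<open>w\<close> itself, viewed as a
  state, cannot be reached.
\<close>

section \<open>Linear dependence and Krylov sequences\<close>

text \<open>Gaussian elimination, one equation per induction step: an unknown \<open>q\<close>
  occurring in equation \<open>s\<close> is eliminated from the others, which leaves one equation
  and one unknown fewer.\<close>

lemma homogeneous_system_nontrivial_solution:
  fixes f :: "'p \<Rightarrow> 's \<Rightarrow> 'a::field"
  assumes "finite S" "finite P" "card S < card P"
  shows "\<exists>c. (\<exists>p\<in>P. c p \<noteq> 0) \<and> (\<forall>s\<in>S. (\<Sum>p\<in>P. c p * f p s) = 0)"
  using assms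
proof (induction S arbitrary: f P rule: finite_induct)
  case empty
  then have "P \<noteq> {}" by auto
  then show ?case by (intro exI[of _ "\<lambda>_. 1"]) auto
next
  case (insert s S)
  show ?case
  proof (cases "\<forall>p\<in>P. f p s = 0")
    case True
    have "card S < card P" using insert by auto
    then obtain c where "\<exists>p\<in>P. c p \<noteq> 0" "\<forall>s\<in>S. (\<Sum>p\<in>P. c p * f p s) = 0"
      using insert.IH[of P f] insert.prems by blast
    with True show ?thesis by (intro exI[of _ c]) auto
  next
    case False
    then obtain q where q: "q \<in> P" "f q s \<noteq> 0" by blast
    define P' where "P' = P - {q}"
    have P': "finite P'" "card S < card P'" "q \<notin> P'" "P = insert q P'"
      using insert q by (auto simp: P'_def)
    define r where "r p = f p s / f q s" for p
    obtain c where c: "\<exists>p\<in>P'. c p \<noteq> 0"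
      and c0: "\<And>x. x \<in> S \<Longrightarrow> (\<Sum>p\<in>P'. c p * (f p x - r p * f q x)) = 0"
      using insert.IH[OF P'(1,2), of "\<lambda>p x. f p x - r p * f q x"] by blast
    \<comment> \<open>Back substitution: the value at \<open>q\<close> is equation \<open>s\<close>
      solved for that unknown.\<close>
    define d where "d = c(q := - (\<Sum>p\<in>P'. c p * r p))"
    have d: "(\<Sum>p\<in>P. d p * f p x) = (\<Sum>p\<in>P'. c p * (f p x - r p * f q x))" for x
    proof -
      have "(\<Sum>p\<in>P'. d p * f p x) = (\<Sum>p\<in>P'. c p * f p x)"
        using P'(3) by (intro sum.cong) (auto simp: d_def)
      then have "(\<Sum>p\<in>P. d p * f p x) = d q * f q x + (\<Sum>p\<in>P'. c p * f p x)"
        using P' by simp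
      also have "\<dots> = (\<Sum>p\<in>P'. c p * (f p x - r p * f q x))"
        by (simp add: d_def sum_distrib_right right_diff_distrib sum_subtractf mult.assoc)
      finally show ?thesis .
    qed
    have "(\<Sum>p\<in>P'. c p * (f p s - r p * f q s)) = 0"
      using q by (simp add: r_def)
    then have "\<forall>x\<in>insert s S. (\<Sum>p\<in>P. d p * f p x) = 0"
      unfolding d using c0 by auto
    moreover have "\<exists>p\<in>P. d p \<noteq> 0"
      using c P'(3,4) by (metis d_def fun_upd_other insert_iff)
    ultimately show ?thesis by blast
  qed
qed

text \<open>An operator on functions over any index set, so that \<open>^^\<close> gives the rows y
  M^p and multi-indices serve as matrix indices without flattening.\<close>

definition row_times_matrix :: "'i set \<Rightarrow> ('i \<Rightarrow> 'i \<Rightarrow> 'a) \<Rightarrow> ('i \<Rightarrow> 'a::field) \<Rightarrow> 'i \<Rightarrow> 'a" where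
  "row_times_matrix I M y s = (\<Sum>r\<in>I. y r * M r s)"

text \<open>Multiplying a relation between the rows y M^p by M on the right shifts every exponent by
  one.\<close>

lemma row_times_matrix_relation:
  fixes y :: "'i \<Rightarrow> 'a::field"
  assumes "\<forall>s\<in>I. (\<Sum>p\<in>P. c p * (row_times_matrix I M ^^ p) y s) = 0"
  shows "\<forall>s\<in>I. (\<Sum>p\<in>P. c p * (row_times_matrix I M ^^ (m + p)) y s) = 0"
proof (induction m)
  case 0
  then show ?case using assms by simp
next
  case (Suc m)
  let ?T = "row_times_matrix I M"
  have "(\<Sum>p\<in>P. c p * (?T ^^ (Suc m + p)) y s)
      = (\<Sum>r\<in>I. (\<Sum>p\<in>P. c p * (?T ^^ (m + p)) y r) * M r s)" for s
  proof -
    have "(\<Sum>p\<in>P. c p * (?T ^^ (Suc m + p)) y s)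
        = (\<Sum>p\<in>P. \<Sum>r\<in>I. c p * (?T ^^ (m + p)) y r * M r s)"
      by (simp add: row_times_matrix_def sum_distrib_left mult.assoc)
    also have "\<dots> = (\<Sum>r\<in>I. \<Sum>p\<in>P. c p * (?T ^^ (m + p)) y r * M r s)"
      by (rule sum.swap)
    finally show ?thesis by (simp add: sum_distrib_right)
  qed
  with Suc show ?case by simp
qed

text \<open>Among the first \<open>card I + 1\<close> rows \<open>y M\<^sup>p\<close> there is a linear relation; solving it for its last
  term expresses every later row through earlier ones, so Cayley--Hamilton is not needed.\<close>

lemma krylov_annihilator:
  fixes y b :: "'i \<Rightarrow> 'a::field"
  assumes "finite I"
    and zero: "\<And>p. p < card I \<Longrightarrow> (\<Sum>s\<in>I. (row_times_matrix I M ^^ p) y s * b s) = 0"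
  shows "(\<Sum>s\<in>I. (row_times_matrix I M ^^ n) y s * b s) = 0"
proof (induction n rule: less_induct)
  case (less n)
  let ?y = "\<lambda>p. (row_times_matrix I M ^^ p) y"
  let ?g = "\<lambda>p. \<Sum>s\<in>I. ?y p s * b s"
  obtain c where c: "\<exists>p\<in>{..card I}. c p \<noteq> 0"
    and rel: "\<forall>s\<in>I. (\<Sum>p\<in>{..card I}. c p * ?y p s) = 0"
    using homogeneous_system_nontrivial_solution[OF \<open>finite I\<close>, of "{..card I}" ?y] by auto
  \<comment> \<open>\<open>q\<close> is the last exponent that really occurs in the relation; after
    a shift by \<open>n - q\<close> its term is y M^n.\<close>
  define q where "q = Max {p\<in>{..card I}. c p \<noteq> 0}"
  have "q \<in> {p\<in>{..card I}. c p \<noteq> 0}"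
    unfolding q_def using c by (intro Max_in) auto
  then have q: "q \<le> card I" "c q \<noteq> 0" by auto
  have above: "c p = 0" if "p \<le> card I" "q < p" for p
    using that Max_ge[of "{p\<in>{..card I}. c p \<noteq> 0}" p] by (fastforce simp: q_def)
  show ?case
  proof (cases "n < card I")
    case True
    then show ?thesis by (rule zero)
  next
    case False
    define m where "m = n - q"
    have n: "n = m + q" using False q by (simp add: m_def)
    have "0 = (\<Sum>s\<in>I. (\<Sum>p\<in>{..card I}. c p * ?y (m + p) s) * b s)"
      using row_times_matrix_relation[OF rel, of m] by simp
    also have "\<dots> = (\<Sum>p\<in>{..card I}. c p * ?g (m + p))"
      by (simp add: sum_distrib_right sum_distrib_left mult.assoc sum.swap[of _ I])
    \<comment> \<open>Terms with \<open>p < q\<close> have exponent below \<open>n\<close> and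
      vanish by induction; terms with \<open>p > q\<close> have coefficient zero.\<close>
    also have "\<dots> = (\<Sum>p\<in>{q}. c p * ?g (m + p))"
    proof (rule sum.mono_neutral_right)
      show "\<forall>p\<in>{..card I} - {q}. c p * ?g (m + p) = 0"
      proof
        fix p assume p: "p \<in> {..card I} - {q}"
        show "c p * ?g (m + p) = 0"
        proof (cases "p < q")
          case True
          then show ?thesis using less.IH[of "m + p"] n by simp
        next
          case False
          then show ?thesis using above[of p] p by simp
        qed
      qed
    qed (use q in auto)
    finally show ?thesis using q n by simp
  qed
qed

text \<open>A maximal independent set of columns has fewer than \<open>n\<close> elements, so
  orthogonality to it imposes fewer equations than \<open>v\<close> has coordinates. By maximality
  the other columns lie in its span.\<close>

lemma (in vec_space) rank_less_imp_left_annihilator: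
  assumes A: "A \<in> carrier_mat n nc" and "rank A \<noteq> n"
  shows "\<exists>v\<in>carrier_vec n. v \<noteq> 0\<^sub>v n \<and> (\<forall>u\<in>set (cols A). v \<bullet> u = 0)"
proof -
  obtain S where S: "maximal S (\<lambda>T. T \<subseteq> set (cols A) \<and> lin_indpt T)"
    using maximal_exists_superset[of "set (cols A)" "\<lambda>T. T \<subseteq> set (cols A) \<and> lin_indpt T" "{}"]
    by (auto simp: lindep_span)
  have cols: "set (cols A) \<subseteq> carrier_vec n" using cols_dim A by blast
  have SA: "S \<subseteq> set (cols A)" and indpt: "lin_indpt S"
    using S by (auto simp: maximal_def)
  have fin: "finite S" using SA by (rule finite_subset) simp
  have carr: "S \<subseteq> carrier_vec n" using SA cols by blast
  \<comment> \<open>The rank never exceeds \<open>n\<close>, so being different from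
    \<open>n\<close> means being smaller.\<close>
  have "card S \<le> n" using li_le_dim(2)[OF fin_dim] indpt carr by (simp add: dim_is_n)
  moreover have "rank A = card S" by (rule rank_card_indpt[OF A S])
  ultimately have "card S < card {..<n}" using assms(2) by simp
  then obtain c where c: "\<exists>i\<in>{..<n}. c i \<noteq> 0"
    and c0: "\<forall>u\<in>S. (\<Sum>i\<in>{..<n}. c i * u $ i) = 0"
    using homogeneous_system_nontrivial_solution[OF fin, of "{..<n}" "\<lambda>i u. u $ i"] by auto
  define v where "v = vec n c"
  have v: "v \<in> carrier_vec n" by (simp add: v_def)
  have v_orth: "v \<bullet> u = 0" if "u \<in> S" for u
    using c0 that carr by (auto simp: v_def scalar_prod_def lessThan_atLeast0)
  have "v \<bullet> u = 0" if u: "u \<in> set (cols A)" for u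
  proof (cases "u \<in> S")
    case True
    then show ?thesis by (rule v_orth)
  next
    case False
    then have "\<not> lin_indpt (insert u S)"
      using S u SA by (auto simp: maximal_def)
    then have "u \<in> span S"
      using lin_dep_iff_in_span[of S u] carr indpt False u cols by auto
    moreover have "v \<in> orthogonal_complement S"
      using v v_orth by (simp add: orthogonal_complement_def)
    ultimately show ?thesis
      using in_orthogonal_complement_span[OF carr] by (auto simp: orthogonal_complement_def)
  qed
  moreover have "v \<noteq> 0\<^sub>v n"
    using c by (auto simp: v_def vec_eq_iff)
  ultimately show ?thesis using v by blast
qed

section \<open>Multi-indices\<close>

lemma indices_iff:
  "is \<in> indices ds \<longleftrightarrow> length is = length ds \<and> (\<forall>i<length ds. is ! i < ds ! i)"
  by (auto simp: indices_def list_all2_conv_all_nth)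

lemma indices_Nil [simp]: "indices [] = {[]}"
  by (auto simp: indices_def)

lemma Cons_in_indices_iff [simp]: "i # is \<in> indices (d # ds) \<longleftrightarrow> i < d \<and> is \<in> indices ds"
  by (simp add: indices_def)

lemma indices_Cons: "indices (d # ds) = (\<lambda>(i, is). i # is) ` ({..<d} \<times> indices ds)"
  by (auto simp: indices_def list_all2_Cons2)

lemma finite_indices [simp]: "finite (indices ds)"
  by (induction ds) (simp_all add: indices_Cons)

lemma card_indices: "card (indices ds) = prod_list ds"
proof (induction ds)
  case (Cons d ds)
  have "inj_on (\<lambda>(i, is). i # is) ({..<d} \<times> indices ds)"
    by (auto simp: inj_on_def)
  then show ?case
    using Cons by (simp add: indices_Cons card_image card_cartesian_product)
qed simp

lemma indices_length: "is \<in> indices ds \<Longrightarrow> length is = length ds"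
  by (simp add: indices_iff)

lemma list_update_in_indices:
  "is \<in> indices ds \<Longrightarrow> i < ds ! n \<Longrightarrow> is[n := i] \<in> indices ds"
  by (cases "n < length ds") (auto simp: indices_iff nth_list_update)

lemma rows_Cons2 [simp]: "rows (x # y # ls) = x # rows ls"
  and columns_Cons2 [simp]: "columns (x # y # ls) = y # columns ls"
  by (simp_all add: rows_def columns_def nths_Cons)

lemma rows_splice: "length js = length ks \<Longrightarrow> rows (splice js ks) = js"
  by (induction js ks rule: list_induct2) (simp_all, simp add: rows_def)

lemma columns_splice: "length js = length ks \<Longrightarrow> columns (splice js ks) = ks"
  by (induction js ks rule: list_induct2) (simp_all, simp add: columns_def)

lemma splice_in_indices:
  assumes "js \<in> indices J" "ks \<in> indices K" "length J = length K"
  shows "splice js ks \<in> indices (splice J K)"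
proof -
  have "list_all2 (<) js J" "list_all2 (<) ks K"
    using assms by (simp_all add: indices_def)
  then have "list_all2 (<) (splice js ks) (splice J K)"
    using assms(3)
  proof (induction js J arbitrary: ks K rule: list_all2_induct)
    case (Cons j js J0 J)
    from Cons.prems obtain k ks' K0 K' where "ks = k # ks'" "K = K0 # K'"
      by (cases K; cases ks) auto
    then show ?case using Cons by simp
  qed simp
  then show ?thesis by (simp add: indices_def)
qed

lemma nth_splice_even:
  assumes "length xs = length ys" "n < length xs"
  shows "splice xs ys ! (2 * n) = xs ! n"
  using assms
proof (induction xs ys arbitrary: n rule: list_induct2)
  case (Cons x xs y ys)
  then show ?case by (cases n) simp_all
qed simp

text \<open>Varying an index in an even mode moves only the row part, so a fibre in that mode keeps
  one column index.\<close>

lemma list_update_splice_even: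
  assumes "length xs = length ys"
  shows "(splice xs ys)[2 * n := x] = splice (xs[n := x]) ys"
  using assms
proof (induction xs ys arbitrary: n rule: list_induct2)
  case (Cons x xs y ys)
  then show ?case by (cases n) simp_all
qed simp

text \<open>\<open>block_number\<close> evaluates a mixed-radix numeral, least significant digit
  first; this is its Horner step.\<close>

lemma block_number_Cons: "block_number (P # Ps) (p # ps) = p + P * block_number Ps ps"
proof -
  have "block_number (P # Ps) (p # ps)
      = p + (\<Sum>n<length Ps. ps ! n * (\<Prod>l<Suc n. (P # Ps) ! l))"
    by (simp add: block_number_def sum.lessThan_Suc_shift
        del: sum.lessThan_Suc prod.lessThan_Suc)
  also have "\<dots> = p + P * block_number Ps ps"
    by (simp add: block_number_def prod.lessThan_Suc_shift sum_distrib_left mult.left_commute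
        del: prod.lessThan_Suc)
  finally show ?thesis .
qed

text \<open>The digits come from repeated division with remainder. For \<open>P = J\<close> this
  finds each A^p * B with \<open>p < prod_list J\<close> among the blocks.\<close>

lemma block_number_surj:
  "p < prod_list P \<Longrightarrow> \<exists>ps\<in>indices P. block_number P ps = p"
proof (induction P arbitrary: p)
  case Nil
  then show ?case by (simp add: block_number_def)
next
  case (Cons P Ps)
  have "P > 0" using Cons.prems by (cases P) auto
  have "p div P < prod_list Ps"
    using Cons.prems by (simp add: less_mult_imp_div_less mult.commute)
  then obtain ps where ps: "ps \<in> indices Ps" "block_number Ps ps = p div P"
    using Cons.IH by blast
  then show ?case
    using \<open>P > 0\<close> by (intro bexI[of _ "(p mod P) # ps"]) (simp_all add: block_number_Cons)
qed

section \<open>Fibres of a rank-deficient mode\<close>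

lemma matricization_column:
  assumes "is \<in> indices ds" "m < length ds"
  shows "vec (ds ! m) (\<lambda>i. Y (is[m := i])) \<in> set (cols (matricization ds m Y))"
proof -
  \<comment> \<open>Deleting entry \<open>m\<close> gives the column index of the fibre; reinserting
    \<open>i\<close> there is the list update.\<close>
  let ?is = "take m is @ drop (Suc m) is"
  let ?col = "\<lambda>is. vec (ds ! m) (\<lambda>i. Y (take m is @ i # drop m is))"
  have len: "length is = length ds" using assms(1) by (rule indices_length)
  have "list_all2 (<) (take m is) (take m ds)" "list_all2 (<) (drop (Suc m) is) (drop (Suc m) ds)"
    using assms(1) by (auto simp: indices_def)
  then have "list_all2 (<) ?is (take m ds @ drop (Suc m) ds)"
    by (rule list_all2_appendI)
  then have mem: "?is \<in> set (product_lists (map (upt 0) (take m ds @ drop (Suc m) ds)))"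
    by (simp only: product_lists_set mem_Collect_eq list_all2_map2) (simp add: lessThan_def)
  have col: "?col ?is = vec (ds ! m) (\<lambda>i. Y (is[m := i]))"
    using assms(2) len by (simp add: upd_conv_take_nth_drop min_def)
  have cols: "set (cols (matricization ds m Y))
      = ?col ` set (product_lists (map (upt 0) (take m ds @ drop (Suc m) ds)))"
    unfolding matricization_def by (subst cols_mat_of_cols) auto
  show ?thesis using imageI[OF mem, of ?col] unfolding col cols .
qed

text \<open>The fibres in mode \<open>m\<close> are columns of the matricization, so one left
  annihilator \<open>v\<close> serves all of them.\<close>

lemma mode_rank_deficient:
  assumes "mode_rank ds m Y \<noteq> ds ! m" "m < length ds"
  shows "\<exists>v. (\<exists>i<ds ! m. v i \<noteq> 0) \<and>
    (\<forall>is\<in>indices ds. (\<Sum>i<ds ! m. v i * Y (is[m := i])) = 0)"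
proof -
  interpret vec_space "TYPE(real)" "ds ! m" .
  have "dim_row (matricization ds m Y) = ds ! m"
    by (simp add: matricization_def)
  then have carrier:
    "matricization ds m Y \<in> carrier_mat (ds ! m) (dim_col (matricization ds m Y))"
    by (intro carrier_matI refl)
  obtain v where v: "v \<in> carrier_vec (ds ! m)" "v \<noteq> 0\<^sub>v (ds ! m)"
    and orth: "\<And>u. u \<in> set (cols (matricization ds m Y)) \<Longrightarrow> v \<bullet> u = 0"
    using rank_less_imp_left_annihilator[OF carrier assms(1)[unfolded mode_rank_def]] by blast
  have "\<exists>i<ds ! m. v $ i \<noteq> 0" using v by (auto simp: vec_eq_iff)
  moreover have "(\<Sum>i<ds ! m. v $ i * Y (is[m := i])) = 0" if "is \<in> indices ds" for "is"
    using orth[OF matricization_column[OF that assms(2), of Y]] v(1)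
    by (simp add: scalar_prod_def lessThan_atLeast0)
  ultimately show ?thesis by (intro exI[of _ "($) v"]) blast
qed

text \<open>Inverts the \<open>div\<close>/\<open>mod\<close> decoding in
  \<open>mode_row_block\<close>: \<open>ls\<close> is the position at which block \<open>ps\<close>
  stores its column \<open>ks\<close>.\<close>

lemma mode_row_block_splice:
  assumes "length K = length J" "length P = length J"
    and "js \<in> indices J" "ps \<in> indices P" "ks \<in> indices K"
  defines "ls \<equiv> map2 (+) (map2 (*) K ps) ks"
  shows "ls \<in> indices (map2 (*) K P)"
    and "mode_row_block J K P Z (splice js ls) = Z (block_number P ps) (splice js ks)"
proof -
  have len: "length js = length J" "length ps = length J" "length ks = length J"
    "length ls = length J"
    using assms by (auto simp: indices_length)
  have ls_nth: "ls ! i = K ! i * ps ! i + ks ! i" if "i < length J" for i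
    using that len assms(1) by (simp add: ls_def)
  have lt: "ps ! i < P ! i" "ks ! i < K ! i" if "i < length J" for i
    using that assms by (auto simp: indices_iff)
  have "K ! i * ps ! i + ks ! i < K ! i * P ! i" if "i < length J" for i
  proof -
    have "K ! i * ps ! i + ks ! i < K ! i * Suc (ps ! i)"
      using lt(2)[OF that] by simp
    also have "\<dots> \<le> K ! i * P ! i"
      using lt(1)[OF that] by (intro mult_le_mono2) simp
    finally show ?thesis .
  qed
  then show ls: "ls \<in> indices (map2 (*) K P)"
    using len assms(1,2) ls_nth by (simp add: indices_iff)
  have "(K ! i * ps ! i + ks ! i) div K ! i = ps ! i" if "i < length J" for i
    using lt(2)[OF that] by (simp add: div_mult_self4[OF gr_implies_not0])
  then have "map2 (div) ls K = ps" "map2 (mod) ls K = ks"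
    using len assms(1) ls_nth lt by (auto intro!: nth_equalityI)
  moreover have "splice js ls \<in> indices (splice J (map2 (*) K P))"
    using assms ls by (intro splice_in_indices) auto
  ultimately show "mode_row_block J K P Z (splice js ls) = Z (block_number P ps) (splice js ks)"
    using len by (simp add: mode_row_block_def rows_splice columns_splice)
qed

section \<open>Reachable states\<close>

lemma einstein_mult_splice:
  assumes "js \<in> indices J" "is \<in> indices I" "length J = length I"
  shows "einstein_mult J K I A B (splice js is)
    = (\<Sum>ks\<in>indices K. A (splice js ks) * B (splice ks is))"
  using assms
  by (simp add: einstein_mult_def splice_in_indices rows_splice columns_splice indices_length)

lemma einstein_power_0_mult_splice:
  assumes "js \<in> indices J" "ks \<in> indices K" "length J = length K"
  shows "einstein_mult J J K (einstein_power J A 0) B (splice js ks) = B (splice js ks)"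
proof -
  have "einstein_power J A 0 (splice js is) = (if js = is then 1 else 0)"
    if "is \<in> indices J" for "is"
    using assms that
    by (simp add: identity_tensor_def splice_in_indices rows_splice columns_splice indices_length)
  then show ?thesis
    using assms by (simp add: einstein_mult_splice if_distrib[of "\<lambda>x. x * _"] cong: if_cong)
qed

text \<open>Associativity (A * A^p) * B = A * (A^p * B), read at one entry.\<close>

lemma einstein_power_Suc_mult_splice:
  assumes "js \<in> indices J" "ks \<in> indices K" "length J = length K"
  shows "einstein_mult J J K (einstein_power J A (Suc p)) B (splice js ks)
    = (\<Sum>is\<in>indices J.
        A (splice js is) * einstein_mult J J K (einstein_power J A p) B (splice is ks))"
proof -
  let ?C = "einstein_power J A p"
  have "einstein_mult J J K (einstein_power J A (Suc p)) B (splice js ks)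
      = (\<Sum>hs\<in>indices J. \<Sum>is\<in>indices J.
          A (splice js is) * (?C (splice is hs) * B (splice hs ks)))"
    using assms by (simp add: einstein_mult_splice sum_distrib_right mult.assoc)
  also have "\<dots> = (\<Sum>is\<in>indices J. \<Sum>hs\<in>indices J.
          A (splice js is) * (?C (splice is hs) * B (splice hs ks)))"
    by (rule sum.swap)
  finally show ?thesis
    using assms by (simp add: einstein_mult_splice sum_distrib_left)
qed

text \<open>Associativity (w A^p) B = w (A^p B). It links the rows treated by
  \<open>krylov_annihilator\<close> with the blocks of the reachability tensor.\<close>

lemma row_power_mult:
  fixes A B w :: tensor
  assumes "ks \<in> indices K" "length J = length K"
  defines "T \<equiv> row_times_matrix (indices J) (\<lambda>js is. A (splice js is))"
  shows "(\<Sum>js\<in>indices J. (T ^^ p) w js * B (splice js ks))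
    = (\<Sum>js\<in>indices J. w js * einstein_mult J J K (einstein_power J A p) B (splice js ks))"
proof (induction p arbitrary: w)
  case 0
  then show ?case using assms by (simp add: einstein_power_0_mult_splice del: einstein_power.simps)
next
  case (Suc p)
  let ?C = "einstein_mult J J K (einstein_power J A p) B"
  \<comment> \<open>The induction hypothesis is used for the row \<open>T w\<close>: this splits off
    the leftmost factor A, as \<open>einstein_power\<close> does.\<close>
  have "(\<Sum>js\<in>indices J. (T ^^ Suc p) w js * B (splice js ks))
      = (\<Sum>is\<in>indices J. T w is * ?C (splice is ks))"
    using Suc[of "T w"] by (simp add: funpow_swap1)
  also have "\<dots> = (\<Sum>is\<in>indices J. \<Sum>js\<in>indices J.
      w js * (A (splice js is) * ?C (splice is ks)))"
    by (simp add: T_def row_times_matrix_def sum_distrib_right mult.assoc)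
  also have "\<dots> = (\<Sum>js\<in>indices J. \<Sum>is\<in>indices J.
      w js * (A (splice js is) * ?C (splice is ks)))"
    by (rule sum.swap)
  also have "\<dots> = (\<Sum>js\<in>indices J.
      w js * einstein_mult J J K (einstein_power J A (Suc p)) B (splice js ks))"
    using assms(1,2)
    by (simp add: einstein_power_Suc_mult_splice sum_distrib_left del: einstein_power.simps)
  finally show ?case .
qed

text \<open>Since w A^p X_(t+1) = w A^(p+1) X_t + (w A^p B) U_t, a step in time raises the exponent;
  the induction therefore runs over all \<open>p\<close> at once.\<close>

lemma annihilator_of_reachable_states:
  fixes J K :: "nat list" and A B w :: tensor and X :: "int \<Rightarrow> tensor"
  defines "T \<equiv> row_times_matrix (indices J) (\<lambda>js is. A (splice js is))"
  assumes annih: "\<And>p ks. ks \<in> indices K \<Longrightarrow>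
      (\<Sum>js\<in>indices J. (T ^^ p) w js * B (splice js ks)) = 0"
    and step: "\<forall>t\<in>{t\<^sub>0..t\<^sub>1 - 1}.
      X (t + 1) = tensor_add J (einstein_apply J J A (X t)) (einstein_apply J K B (U t))"
    and init: "\<And>js. js \<in> indices J \<Longrightarrow> X t\<^sub>0 js = 0"
    and t: "t\<^sub>0 \<le> t" "t \<le> t\<^sub>1"
  shows "(\<Sum>js\<in>indices J. (T ^^ p) w js * X t js) = 0"
  using t
proof (induction t arbitrary: p rule: int_ge_induct)
  case base
  then show ?case using init by simp
next
  case (step t)
  have eq: "X (t + 1) = tensor_add J (einstein_apply J J A (X t)) (einstein_apply J K B (U t))"
    using assms(3) step by simp
  have "(\<Sum>js\<in>indices J. (T ^^ p) w js * X (t + 1) js)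
      = (\<Sum>js\<in>indices J. \<Sum>is\<in>indices J. (T ^^ p) w js * A (splice js is) * X t is)
      + (\<Sum>js\<in>indices J. \<Sum>ks\<in>indices K. (T ^^ p) w js * B (splice js ks) * U t ks)"
    by (simp add: eq tensor_add_def einstein_apply_def distrib_left sum.distrib sum_distrib_left
        mult.assoc)
  also have "\<dots>
      = (\<Sum>is\<in>indices J. \<Sum>js\<in>indices J. (T ^^ p) w js * A (splice js is) * X t is)
      + (\<Sum>ks\<in>indices K. \<Sum>js\<in>indices J. (T ^^ p) w js * B (splice js ks) * U t ks)"
    by (intro arg_cong2[where f = "(+)"] sum.swap)
  also have "\<dots> = (\<Sum>is\<in>indices J. (T ^^ Suc p) w is * X t is)
      + (\<Sum>ks\<in>indices K. (\<Sum>js\<in>indices J. (T ^^ p) w js * B (splice js ks)) * U t ks)"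
    by (simp add: T_def row_times_matrix_def sum_distrib_right)
  also have "\<dots> = 0"
    using step.IH[of "Suc p"] step.prems annih by simp
  finally show ?case .
qed

lemma annihilated_imp_not_reachable:
  fixes w :: tensor
  assumes len: "length J = length K"
    and nonzero: "\<exists>js\<in>indices J. w js \<noteq> 0"
    and annih: "\<And>p ks. p < prod_list J \<Longrightarrow> ks \<in> indices K \<Longrightarrow>
      (\<Sum>js\<in>indices J. w js * einstein_mult J J K (einstein_power J A p) B (splice js ks)) = 0"
  shows "\<not> reachable J K A B"
proof
  assume "reachable J K A B"
  then obtain t\<^sub>0 t\<^sub>1 where t: "t\<^sub>0 < t\<^sub>1" "reachable_on J K A B t\<^sub>0 t\<^sub>1"
    by (auto simp: reachable_def)
  define T where "T = row_times_matrix (indices J) (\<lambda>js is. A (splice js is))"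
  \<comment> \<open>\<open>prod_list J\<close> is the number of multi-indices, the dimension of the
    state space, so the Krylov lemma extends \<open>annih\<close> to every exponent.\<close>
  have all: "(\<Sum>js\<in>indices J. (T ^^ p) w js * B (splice js ks)) = 0" if "ks \<in> indices K" for p ks
    unfolding T_def
    by (rule krylov_annihilator)
      (use that len annih in \<open>simp_all add: row_power_mult card_indices\<close>)
  \<comment> \<open>\<open>restrict\<close> makes the target extensional, as \<open>tensors\<close>
    demands; \<open>w\<close> is an arbitrary function.\<close>
  have "(\<lambda>js\<in>indices J. 0) \<in> tensors J" "restrict w (indices J) \<in> tensors J"
    by (auto simp: tensors_def)
  then obtain U X where step: "\<forall>t\<in>{t\<^sub>0..t\<^sub>1 - 1}.
      X (t + 1) = tensor_add J (einstein_apply J J A (X t)) (einstein_apply J K B (U t))"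
    and init: "X t\<^sub>0 = (\<lambda>js\<in>indices J. 0)" and final: "X t\<^sub>1 = restrict w (indices J)"
    using t(2) unfolding reachable_on_def by metis
  \<comment> \<open>At exponent 0 the functional is \<open>w\<close> itself, so its value at the
    final state is a sum of squares.\<close>
  have "(\<Sum>js\<in>indices J. (T ^^ 0) w js * X t\<^sub>1 js) = 0"
    unfolding T_def
    by (rule annihilator_of_reachable_states[OF _ step])
      (use all init t(1) in \<open>simp_all add: T_def\<close>)
  then have "(\<Sum>js\<in>indices J. w js * w js) = 0"
    by (simp add: final)
  then show False
    using nonzero by (simp add: sum_nonneg_eq_0_iff)
qed

theorem corollary5p9:
  fixes N :: nat and J K :: "nat list" and A B :: tensor
  assumes "length J = N" and "length K = N"
    and "\<forall>n<N. J ! n \<ge> 1" and "\<forall>n<N. K ! n \<ge> 1"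
    and "A \<in> tensors (splice J J)"
    and "B \<in> tensors (splice J K)"
    and "\<exists>n<N. mode_rank (splice J (map2 (*) K J)) (2 * n) (reachability_tensor J K A B) \<noteq> J ! n"
  shows "\<not> reachable J K A B"
proof -
  let ?L = "map2 (*) K J"
  let ?R = "reachability_tensor J K A B"
  obtain n where n: "n < N" and rank: "mode_rank (splice J ?L) (2 * n) ?R \<noteq> J ! n"
    using assms(7) by blast
  have lenL: "length J = length ?L" using assms(1,2) by simp
  \<comment> \<open>Counting pairs and modes from zero, \<open>2 * n\<close> is the first mode of
    pair \<open>n\<close>.\<close>
  have mode: "splice J ?L ! (2 * n) = J ! n"
    using nth_splice_even[OF lenL] n assms(1) by simp
  obtain v where v: "\<exists>i<J ! n. v i \<noteq> 0"
    and fibre: "\<And>is. is \<in> indices (splice J ?L) \<Longrightarrow> (\<Sum>i<J ! n. v i * ?R (is[2 * n := i])) = 0"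
    using mode_rank_deficient[of "splice J ?L" "2 * n" ?R] rank n assms(1,2)
    by (auto simp: mode)
  \<comment> \<open>\<open>e i\<close> is the point with coordinate \<open>i\<close> on the line
    through the origin in direction \<open>n\<close>; the test \<open>js = e (js ! n)\<close> below
    decides membership in this line.\<close>
  define e where "e i = (replicate N 0)[n := i]" for i :: nat
  define w where "w js = (if js = e (js ! n) then v (js ! n) else 0)" for js
  \<comment> \<open>The origin is an admissible multi-index because all sizes in \<open>J\<close>
    are positive.\<close>
  have zero: "replicate N 0 \<in> indices J"
    using assms(1,3) by (auto simp: indices_iff Suc_le_eq)
  have e_nth: "e i ! n = i" for i using n by (simp add: e_def)
  have e_in: "e i \<in> indices J" if "i < J ! n" for i
    unfolding e_def using zero that by (rule list_update_in_indices)
  have e_sub: "e ` {..<J ! n} \<subseteq> indices J" using e_in by auto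
  \<comment> \<open>Pairing with \<open>w\<close> collapses to the line, where it becomes the
    pairing of \<open>v\<close> with a fibre.\<close>
  have sum_w: "(\<Sum>js\<in>indices J. w js * F js) = (\<Sum>i<J ! n. v i * F (e i))" for F
  proof -
    have outside: "w js = 0" if "js \<in> indices J - e ` {..<J ! n}" for js
    proof -
      have "js ! n < J ! n" using that n assms(1) by (simp add: indices_iff)
      then show ?thesis using that by (auto simp: w_def)
    qed
    have "(\<Sum>js\<in>indices J. w js * F js) = (\<Sum>js\<in>e ` {..<J ! n}. w js * F js)"
      by (intro sum.mono_neutral_right e_sub) (auto simp: outside)
    also have "\<dots> = (\<Sum>i<J ! n. w (e i) * F (e i))"
      by (subst sum.reindex) (auto intro: inj_on_inverseI[where g = "\<lambda>js. js ! n"] simp: e_nth)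
    finally show ?thesis by (simp add: w_def e_nth)
  qed
  show ?thesis
  proof (rule annihilated_imp_not_reachable[where w = w])
    show "length J = length K" using assms(1,2) by simp
    show "\<exists>js\<in>indices J. w js \<noteq> 0"
      using v e_in by (metis e_nth w_def)
  next
    fix p ks assume p: "p < prod_list J" and ks: "ks \<in> indices K"
    let ?Z = "\<lambda>p. einstein_mult J J K (einstein_power J A p) B"
    obtain ps where ps: "ps \<in> indices J" "block_number J ps = p"
      using block_number_surj[OF p] by blast
    \<comment> \<open>The digits \<open>ps\<close> select block \<open>p\<close>, and
      \<open>ls\<close> locates column \<open>ks\<close> in it. As \<open>ls\<close> is the same for
      all rows, the entries at rows \<open>e i\<close> form one fibre in mode
      \<open>2 * n\<close>.\<close>
    define ls where "ls = map2 (+) (map2 (*) K ps) ks"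
    have block: "ls \<in> indices ?L" "?R (splice js ls) = ?Z p (splice js ks)"
      if "js \<in> indices J" for js
      using mode_row_block_splice[of K J J js ps ks] that ps ks assms(1,2)
      by (simp_all add: ls_def reachability_tensor_def)
    have ls: "ls \<in> indices ?L" using block(1)[OF zero] .
    have "length (replicate N 0 :: nat list) = length ls"
      using indices_length[OF ls] assms(1,2) by simp
    then have "(splice (replicate N 0) ls)[2 * n := i] = splice (e i) ls" for i
      unfolding e_def by (rule list_update_splice_even)
    then have "(\<Sum>i<J ! n. v i * ?R (splice (e i) ls)) = 0"
      using fibre[OF splice_in_indices[OF zero ls lenL]] by simp
    then show "(\<Sum>js\<in>indices J. w js * ?Z p (splice js ks)) = 0"
      unfolding sum_w using block(2) e_in by simp
  qed
qed

end
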